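(* Let $X=(X_1,X_2;\Sigma;\varphi)\in\mathfrak{X}_1$. If $X$ has a regular limit cycle, then $|\varphi'(0)|\neq 1$. Moreover, if a regular limit cycle exists, then it is unique (as a regular limit cycle of $X$), hyperbolic, stable if $|\varphi'(0)|<1$ and unstable if $|\varphi'(0)|>1$, and it has period one.
   Context: Let $\Sigma=\{(x,y)\in\mathbb{R}^2: x=0\}$, $A_1=\{(x,y)\in\mathbb{R}^2: x<0\}$, $A_2=\{(x,y)\in\mathbb{R}^2: x>0\}$. Points $(0,y)\in\Sigma$ are identified with $y\in\mathbb{R}$, and maps $\Sigma\to\Sigma$ with maps $\mathbb{R}\to\mathbb{R}$. For $n\geqslant 1$, $\mathfrak{X}_n$ is the class of hybrid systems $X=(X_1,X_2;\Sigma;\varphi)$ where, for $i\in\{1,2\}$, $X_i$ is a linear (possibly non-homogeneous, i.e. affine) planar vector field with a center singularity, defined over the closure $\overline{A_i}$ (so the non-constant orbits of the vector field in the plane are ellipses), and $\varphi:\Sigma\to\Sigma$ (the reset map) is a polynomial of degree $n$. In particular, for $n=1$, $\varphi(y)=ay+b$ with $a\neq0$, and $\varphi'(0)=a$. First return map $P:\Sigma\to\Sigma$. Say that $X_i$ enters $A_i$ at $y\in\Sigma$ if the solution of $X_i$ starting at $(0,y)$ lies in $A_i$ for all sufficiently small positive times. Given $y_1\in\Sigma$: if $X_1$ enters $A_1$ at $y_1$, follow the solution of $X_1$ until it first returns to $\Sigma$, at a point $y_2$; otherwise set $y_2=y_1$. Jump to $y_3=\varphi(y_2)$. If $X_2$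 enters $A_2$ at $y_3$, follow the solution of $X_2$ until it first returns to $\Sigma$, at a point $y_4$; otherwise set $y_4=y_3$. Jump to $P(y_1)=\varphi(y_4)$. The orbit through $y\in\Sigma$ is periodic if $P^m(y)=y$ for some $m\geqslant1$. It is a limit cycle if $y$ is an isolated periodic point of $P$; the minimal $m\geqslant 1$ with $P^m(y)=y$ is the period of the limit cycle. The limit cycle is regular if the orientations of its pieces of orbits of $X_1$ and $X_2$ agree, i.e. if along the cycle, in the construction above, $X_1$ enters $A_1$ at $y_1$ and $X_2$ enters $A_2$ at $y_3$ (so that the cycle really follows a piece of orbit of $X_1$ in $A_1$, jumps, follows a piece of orbit of $X_2$ in $A_2$, and jumps again). The displacement map is $d(y)=P(y)-y$. A regular limit cycle with associated zero $y_0$ of $d$ is hyperbolic if $d'(y_0)\neq0$; in that case it is stable if $d'(y_0)<0$ and unstable if $d'(y_0)>0$.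
   Formalization: Hyperbolicity and stability are claimed only when X_1 is not tangent to Σ at y_1 and X_2 is not tangent to Σ at y_3; at a tangent regular limit cycle d'(y_0) does not exist. The claims |φ'(0)|≠1, uniqueness and period one are made for all regular limit cycles. *)

theory Defs
  imports "HOL-Analysis.Analysis"
begin

type_synonym plane = "real \<times> real"
type_synonym vector_field = "plane \<Rightarrow> plane"

definition Sigma_line :: "plane set" where
  "Sigma_line = {p. fst p = 0}"

definition A1 :: "plane set" where
  "A1 = {p. fst p < 0}"

definition A2 :: "plane set" where
  "A2 = {p. fst p > 0}"

definition is_solution :: "vector_field \<Rightarrow> plane \<Rightarrow> (real \<Rightarrow> plane) \<Rightarrow> bool" where
  "is_solution f p x \<longleftrightarrow>
     x 0 = p \<and> (\<forall>t. (x has_vector_derivative f (x t)) (at t))"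

text \<open>Only used for affine fields, whose solutions exist for all times and are unique.\<close>
definition flow :: "vector_field \<Rightarrow> plane \<Rightarrow> real \<Rightarrow> plane" where
  "flow f p = (THE x. is_solution f p x)"

text \<open>``Linear'' vector fields may be non-homogeneous.\<close>
definition affine_field :: "vector_field \<Rightarrow> bool" where
  "affine_field f \<longleftrightarrow> (\<exists>L v. linear L \<and> f = (\<lambda>p. L p + v))"

text \<open>A singularity with a punctured neighbourhood filled by non-constant periodic orbits.\<close>
definition is_center :: "vector_field \<Rightarrow> plane \<Rightarrow> bool" where
  "is_center f c \<longleftrightarrow> f c = 0 \<and>
     (\<exists>U. open U \<and> c \<in> U \<and>
       (\<forall>p\<in>U - {c}. f p \<noteq> 0 \<and>
         (\<exists>x T. is_solution f p x \<and> T > 0 \<and> (\<forall>t. x (t + T) = x t))))"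

text \<open>An affine field on a closed half-plane extends uniquely to the plane, and the fields below
  are these extensions. The center may lie on either side of the line or on the line itself.\<close>
record hybrid_system =
  field1 :: vector_field
  field2 :: vector_field
  reset :: "real poly"

definition hybrid_class :: "nat \<Rightarrow> hybrid_system set" where
  "hybrid_class n = {X. n \<ge> 1 \<and>
     affine_field (field1 X) \<and> (\<exists>c. is_center (field1 X) c) \<and>
     affine_field (field2 X) \<and> (\<exists>c. is_center (field2 X) c) \<and>
     degree (reset X) = n}"

definition enters :: "vector_field \<Rightarrow> plane set \<Rightarrow> real \<Rightarrow> bool" where
  "enters f A y \<longleftrightarrow> (\<forall>\<^sub>F t in at_right 0. flow f (0, y) t \<in> A)"

definition return_time :: "vector_field \<Rightarrow> real \<Rightarrow> real" where
  "return_time f y = (LEAST t. t > 0 \<and> flow f (0, y) t \<in> Sigma_line)"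

definition half_map :: "vector_field \<Rightarrow> plane set \<Rightarrow> real \<Rightarrow> real" where
  "half_map f A y =
     (if enters f A y then snd (flow f (0, y) (return_time f y)) else y)"

text \<open>The point \<open>y\<^sub>3\<close> at which the orbit through \<open>y\<^sub>1 = y\<close> meets the second field.\<close>
definition mid_point :: "hybrid_system \<Rightarrow> real \<Rightarrow> real" where
  "mid_point X y = poly (reset X) (half_map (field1 X) A1 y)"

definition return_map :: "hybrid_system \<Rightarrow> real \<Rightarrow> real" where
  "return_map X y = poly (reset X) (half_map (field2 X) A2 (mid_point X y))"

definition displacement :: "hybrid_system \<Rightarrow> real \<Rightarrow> real" where
  "displacement X y = return_map X y - y"

definition periodic_points :: "hybrid_system \<Rightarrow> real set" where
  "periodic_points X = {y. \<exists>m\<ge>1. (return_map X ^^ m) y = y}"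

definition limit_cycle :: "hybrid_system \<Rightarrow> real \<Rightarrow> bool" where
  "limit_cycle X y \<longleftrightarrow> y isolated_in periodic_points X"

definition cycle_period :: "hybrid_system \<Rightarrow> real \<Rightarrow> nat" where
  "cycle_period X y = (LEAST m. m \<ge> 1 \<and> (return_map X ^^ m) y = y)"

text \<open>The condition is imposed on every turn of the cycle, since its period may exceed one.\<close>
definition regular_limit_cycle :: "hybrid_system \<Rightarrow> real \<Rightarrow> bool" where
  "regular_limit_cycle X y \<longleftrightarrow> limit_cycle X y \<and>
     (\<forall>k. enters (field1 X) A1 ((return_map X ^^ k) y) \<and>
          enters (field2 X) A2 (mid_point X ((return_map X ^^ k) y)))"

text \<open>The three predicates below include the existence of the two-sided derivative of the
  displacement map.\<close>
definition hyperbolic :: "hybrid_system \<Rightarrow> real \<Rightarrow> bool" where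
  "hyperbolic X y \<longleftrightarrow> (\<exists>D. (displacement X has_real_derivative D) (at y) \<and> D \<noteq> 0)"

definition stable_cycle :: "hybrid_system \<Rightarrow> real \<Rightarrow> bool" where
  "stable_cycle X y \<longleftrightarrow> (\<exists>D. (displacement X has_real_derivative D) (at y) \<and> D < 0)"

definition unstable_cycle :: "hybrid_system \<Rightarrow> real \<Rightarrow> bool" where
  "unstable_cycle X y \<longleftrightarrow> (\<exists>D. (displacement X has_real_derivative D) (at y) \<and> D > 0)"

text \<open>An orbit can enter a half-plane while tangent to the line: the orbit is then a whole ellipse
  touching the line at the starting point. The half-plane map is the identity on one side of such
  a point and a reflection on the other, so the displacement map has a corner there.
  The condition below excludes this.\<close>
definition crosses_transversally :: "hybrid_system \<Rightarrow> real \<Rightarrow> bool" where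
  "crosses_transversally X y \<longleftrightarrow>
     fst (field1 X (0, y)) \<noteq> 0 \<and> fst (field2 X (0, mid_point X y)) \<noteq> 0"

end

theory Submission
  imports Defs
begin

text \<open>
  An affine field with a center generates a linear rotation about the center: up to an affine
  change of coordinates the orbits are circles run through at constant angular speed. An ellipse
  meets \<open>\<Sigma>\<close> symmetrically about the point \<open>m\<close> where the field is tangent to \<open>\<Sigma>\<close>, and this
  point is common to all orbits of the field. The half-plane map is therefore the
  reflection \<open>y \<mapsto> 2 * m - y\<close> on a half-line ending at \<open>m\<close> and the identity elsewhere
  (lemma \<open>center_half_map_reflects\<close>).

  With the reset map \<open>y \<mapsto> a * y + b\<close>, the return map at a point where both
  fields enter their half-planes is a composition of two reflections and two affine maps of
  slope \<open>a\<close>, hence is given by an affine map of slope \<open>a\<^sup>2\<close>. Along a regular cycle the increments of the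
  orbit form a geometric sequence with the nonnegative ratio \<open>a\<^sup>2\<close>, all of one sign, so the orbit
  can only close up if it is constant: the period is one. If \<open>a\<^sup>2 \<noteq> 1\<close>, the affine map has just one fixed
  point, which gives uniqueness, and the derivative of the displacement map is \<open>a\<^sup>2 - 1\<close> as soon
  as the regular formula holds in a neighbourhood, as it does when both crossings are transversal.

  If \<open>a\<^sup>2 = 1\<close>, a regular fixed point makes the affine map the identity, so all regular points
  are fixed, and the cycle is not isolated as soon as regular points accumulate at it. The only
  obstacle is a double tangency, where the set of regular points may consist of the cycle alone.
  In that case, on one side of the cycle, neither field is entered, the return map is the square
  of the reset map there, and this is again the identity
  (lemmas \<open>one_sided_regular_or_neutral\<close> and \<open>regular_cycle_slope\<close>).
\<close>

section \<open>Affine centers of the plane\<close>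

lemma bounded_exponential_zero:
  fixes z :: "real \<Rightarrow> 'a::real_normed_vector"
  assumes deriv: "\<And>t. (z has_vector_derivative k *\<^sub>R z t) (at t)"
    and "k \<noteq> 0" and "bounded (range z)"
  shows "z t = 0"
proof -
  have "((\<lambda>s. exp (- k * s) *\<^sub>R z s) has_vector_derivative 0) (at s)" for s
    by (auto intro!: derivative_eq_intros deriv)
  then obtain w where w: "\<And>s. exp (- k * s) *\<^sub>R z s = w"
    using has_vector_derivative_zero_constant [of UNIV "\<lambda>s. exp (- k * s) *\<^sub>R z s"] by auto
  have z: "z s = exp (k * s) *\<^sub>R w" for s
    by (simp add: w [symmetric, of s] exp_minus)
  obtain B where "B > 0" and B: "\<And>s. norm (z s) \<le> B"
    using \<open>bounded (range z)\<close> unfolding bounded_pos by auto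
  have "w = 0"
  proof (rule ccontr)
    assume "w \<noteq> 0"
    define s where "s = ln ((B + 1) / norm w) / k"
    have "exp (k * s) = (B + 1) / norm w"
      using \<open>w \<noteq> 0\<close> \<open>B > 0\<close> \<open>k \<noteq> 0\<close> by (simp add: s_def)
    then have "norm (z s) = B + 1"
      using \<open>w \<noteq> 0\<close> \<open>B > 0\<close> by (simp add: z)
    with B [of s] show False by simp
  qed
  then show ?thesis by (simp add: z)
qed

lemma periodic_solution_bounded:
  assumes "is_solution f p x" and "T > 0" and per: "\<And>t. x (t + T) = x t"
  shows "bounded (range x)"
proof -
  have shift: "x (t + of_int n * T) = x t" for t and n :: int
  proof (induction n rule: int_induct [where k = 0])
    case (step1 i)
    then show ?case using per [of "t + of_int i * T"] by (simp add: algebra_simps)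
  next
    case (step2 i)
    then show ?case using per [of "t + of_int (i - 1) * T"] by (simp add: algebra_simps)
  qed simp
  have "continuous_on {0..T} x"
    using assms(1) unfolding is_solution_def
    by (auto intro!: continuous_at_imp_continuous_on dest: has_vector_derivative_continuous)
  then have "bounded (x ` {0..T})"
    by (intro compact_imp_bounded compact_continuous_image) auto
  moreover have "range x \<subseteq> x ` {0..T}"
  proof (rule image_subsetI)
    fix t
    define r where "r = t - of_int \<lfloor>t / T\<rfloor> * T"
    have "r \<in> {0..T}"
      using floor_divide_lower [OF \<open>T > 0\<close>, of t] floor_divide_upper [OF \<open>T > 0\<close>, of t]
      by (simp add: r_def algebra_simps)
    moreover have "x t = x r"
      using shift [of r "\<lfloor>t / T\<rfloor>"] by (simp add: r_def)
    ultimately show "x t \<in> x ` {0..T}" by blast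
  qed
  ultimately show ?thesis using bounded_subset by blast
qed

text \<open>By homogeneity of the linear part, what a center says about a small neighbourhood holds for
  every nonzero initial vector.\<close>

lemma center_orbits_bounded:
  assumes "linear L" and f: "f = (\<lambda>p. L (p - c))" and "is_center f c" and "u \<noteq> 0"
  obtains x where "L u \<noteq> 0" "x 0 = u" "\<And>t. (x has_vector_derivative L (x t)) (at t)"
    "bounded (range x)"
proof -
  interpret linear L by fact
  obtain U where "open U" "c \<in> U"
    and U: "\<And>p. p \<in> U - {c} \<Longrightarrow> f p \<noteq> 0 \<and>
          (\<exists>x T. is_solution f p x \<and> T > 0 \<and> (\<forall>t. x (t + T) = x t))"
    using \<open>is_center f c\<close> unfolding is_center_def by blast
  obtain e where "e > 0" and e: "ball c e \<subseteq> U"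
    using \<open>open U\<close> \<open>c \<in> U\<close> openE by blast
  define q where "q = e / (2 * norm u)"
  have "q > 0" using \<open>e > 0\<close> \<open>u \<noteq> 0\<close> by (simp add: q_def)
  have "norm (q *\<^sub>R u) < e" using \<open>e > 0\<close> \<open>u \<noteq> 0\<close> by (simp add: q_def)
  then have "c + q *\<^sub>R u \<in> U - {c}"
    using subsetD [OF e, of "c + q *\<^sub>R u"] \<open>q > 0\<close> \<open>u \<noteq> 0\<close> by (simp add: dist_norm)
  from U [OF this] obtain x T where nz: "f (c + q *\<^sub>R u) \<noteq> 0"
    and sol: "is_solution f (c + q *\<^sub>R u) x" and "T > 0" and per: "\<And>t. x (t + T) = x t"
    by blast
  have bd: "bounded (range x)"
    using periodic_solution_bounded [OF sol \<open>T > 0\<close> per] .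
  let ?y = "\<lambda>t. (1 / q) *\<^sub>R (x t - c)"
  show thesis
  proof (rule that [of ?y])
    show "L u \<noteq> 0" using nz by (auto simp: f scale)
    show "?y 0 = u" using sol \<open>q > 0\<close> by (simp add: is_solution_def)
    have "(x has_vector_derivative L (x t - c)) (at t)" for t
      using sol by (simp add: is_solution_def f)
    then show "(?y has_vector_derivative L (?y t)) (at t)" for t
      unfolding scale by (auto intro!: derivative_eq_intros)
    have "range ?y = (\<lambda>p. (1 / q) *\<^sub>R p) ` (\<lambda>p. p - c) ` range x" by auto
    then show "bounded (range ?y)"
      using bd by (simp only: bounded_scaling bounded_translation_minus)
  qed
qed

lemma linear_plane_coordinates:
  assumes "linear (L :: plane \<Rightarrow> plane)"
  obtains \<alpha> \<beta> \<gamma> \<delta> where "\<And>p. L p = (\<alpha> * fst p + \<beta> * snd p, \<gamma> * fst p + \<delta> * snd p)"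
proof -
  interpret linear L by fact
  have basis: "L p = fst p *\<^sub>R L (1, 0) + snd p *\<^sub>R L (0, 1)" for p
    by (simp add: scale [symmetric] add [symmetric])
  have "L p = (fst (L (1,0)) * fst p + fst (L (0,1)) * snd p,
                    snd (L (1,0)) * fst p + snd (L (0,1)) * snd p)" for p
    using basis [of p] by (simp add: prod_eq_iff mult.commute)
  then show thesis using that by blast
qed

text \<open>The bounded orbits determine trace and determinant of the linear part. By Liouville's formula
  the Wronskian of two solutions grows like the exponential of the trace, so the trace is zero, and
  the square of the linear part is a scalar by Cayley--Hamilton. If the determinant were negative,
  with \<open>\<kappa>\<^sup>2\<close> its absolute value, then \<open>L u + \<kappa> u\<close> would grow exponentially along each solution
  unless it is zero; so \<open>L\<close> would be \<open>- \<kappa>\<close> times the identity, whose trace is not zero.\<close>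

lemma center_normal_form:
  assumes "affine_field f" and "is_center f c"
  obtains L \<omega> where "linear L" "\<omega> > 0" "\<And>u. L (L u) = - (\<omega>\<^sup>2) *\<^sub>R u" "f = (\<lambda>p. L (p - c))"
proof -
  obtain L v where "linear L" and Lv: "f = (\<lambda>p. L p + v)"
    using assms(1) unfolding affine_field_def by blast
  interpret linear L by fact
  have "f c = 0" using assms(2) unfolding is_center_def by blast
  then have f: "f = (\<lambda>p. L (p - c))" 
    by (auto simp: Lv diff fun_eq_iff add_eq_0_iff)
  obtain \<alpha> \<beta> \<gamma> \<delta> where co: "\<And>p. L p = (\<alpha> * fst p + \<beta> * snd p, \<gamma> * fst p + \<delta> * snd p)"
    using linear_plane_coordinates [OF \<open>linear L\<close>] by blast
  note orbit = center_orbits_bounded [OF \<open>linear L\<close> f \<open>is_center f c\<close>]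
  have "\<alpha> + \<delta> = 0"
  proof (rule ccontr)
    assume tr: "\<alpha> + \<delta> \<noteq> 0"
    obtain x where x: "x 0 = (1, 0)" "bounded (range x)"
      and dx: "\<And>t. (x has_vector_derivative L (x t)) (at t)"
      using orbit [of "(1, 0)"] by (auto simp: zero_prod_def)
    obtain y where y: "y 0 = (0, 1)" "bounded (range y)"
      and dy: "\<And>t. (y has_vector_derivative L (y t)) (at t)"
      using orbit [of "(0, 1)"] by (auto simp: zero_prod_def)
    \<comment> \<open>the Wronskian\<close>
    let ?W = "\<lambda>t. fst (x t) * snd (y t) - snd (x t) * fst (y t)"
    have fs: "((\<lambda>t. fst (z t)) has_real_derivative \<alpha> * fst (z t) + \<beta> * snd (z t)) (at t)"
        "((\<lambda>t. snd (z t)) has_real_derivative \<gamma> * fst (z t) + \<delta> * snd (z t)) (at t)"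
      if "\<And>t. (z has_vector_derivative L (z t)) (at t)" for z and t :: real
      using has_derivative_fst [OF that [of t, unfolded has_vector_derivative_def]]
        has_derivative_snd [OF that [of t, unfolded has_vector_derivative_def]]
      by (simp_all add: co has_field_derivative_def mult.commute [of _ "_ + _"])
    have "(?W has_vector_derivative (\<alpha> + \<delta>) *\<^sub>R ?W t) (at t)" for t
      unfolding has_real_derivative_iff_has_vector_derivative [symmetric]
      by (rule derivative_eq_intros fs [OF dx] fs [OF dy] refl)+ (simp add: algebra_simps)
    moreover have "bounded (range ?W)"
    proof -
      obtain B C where B: "\<And>t. norm (x t) \<le> B" and C: "\<And>t. norm (y t) \<le> C"
        using x(2) y(2) unfolding bounded_iff by auto
      have "norm (?W t) \<le> B * C + B * C" for t
      proof -
        have "\<bar>fst (x t)\<bar> \<le> B" "\<bar>snd (x t)\<bar> \<le> B"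
          using B [of t] norm_fst_le [of "fst (x t)" "snd (x t)"]
            norm_snd_le [of "snd (x t)" "fst (x t)"] by auto
        moreover have "\<bar>fst (y t)\<bar> \<le> C" "\<bar>snd (y t)\<bar> \<le> C"
          using C [of t] norm_fst_le [of "fst (y t)" "snd (y t)"]
            norm_snd_le [of "snd (y t)" "fst (y t)"] by auto
        ultimately have "\<bar>fst (x t) * snd (y t)\<bar> \<le> B * C" "\<bar>snd (x t) * fst (y t)\<bar> \<le> B * C"
          by (auto simp: abs_mult intro!: mult_mono intro: order_trans [OF abs_ge_zero])
        then show ?thesis by simp
      qed
      then show ?thesis unfolding bounded_iff by blast
    qed
    ultimately have "?W 0 = 0"
      using bounded_exponential_zero [of ?W "\<alpha> + \<delta>"] tr by blast
    then show False by (simp add: x y)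
  qed
  define D where "D = \<alpha> * \<delta> - \<beta> * \<gamma>"
  have "\<delta> = - \<alpha>" using \<open>\<alpha> + \<delta> = 0\<close> by simp
  have LL: "L (L u) = (- D) *\<^sub>R u" for u
    by (simp add: co D_def \<open>\<delta> = - \<alpha>\<close> prod_eq_iff algebra_simps)
  have "D > 0"
  proof (rule ccontr)
    assume "\<not> D > 0"
    define \<kappa> where "\<kappa> = sqrt (- D)"
    have D: "- D = \<kappa> * \<kappa>" using \<open>\<not> D > 0\<close> by (simp add: \<kappa>_def)
    \<comment> \<open>the determinant vanishes only if the linear part is nilpotent and so kills a nonzero vector\<close>
    have "D \<noteq> 0"
    proof
      assume "D = 0"
      have "L (1, 0) \<noteq> 0" by (rule orbit [of "(1, 0)"]) (auto simp: zero_prod_def)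
      then have "L (L (1, 0)) \<noteq> 0" by (rule orbit)
      then show False using LL [of "(1, 0)"] \<open>D = 0\<close> by (simp add: zero_prod_def)
    qed
    then have "\<kappa> \<noteq> 0" using D by auto
    have eig: "L u = (- \<kappa>) *\<^sub>R u" if u: "u \<noteq> 0" for u
    proof -
      obtain x where x: "x 0 = u" "bounded (range x)"
        and dx: "\<And>t. (x has_vector_derivative L (x t)) (at t)"
        using orbit [OF u] by blast
      let ?z = "\<lambda>t. L (x t) + \<kappa> *\<^sub>R x t"
      have "bounded_linear (\<lambda>p. L p + \<kappa> *\<^sub>R p)"
        by (intro bounded_linear_add bounded_linear_scaleR_right linear_conv_bounded_linear
            [THEN iffD1] \<open>linear L\<close>)
      then have "bounded ((\<lambda>p. L p + \<kappa> *\<^sub>R p) ` range x)"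
        by (rule bounded_linear_image [OF x(2)])
      then have "bounded (range ?z)" by (simp add: image_image)
      moreover have dLx: "((\<lambda>t. L (x t)) has_vector_derivative L (L (x t))) (at t)" for t
        using bounded_linear.has_vector_derivative dx
          linear_conv_bounded_linear [THEN iffD1, OF \<open>linear L\<close>] by blast
      have "(?z has_vector_derivative \<kappa> *\<^sub>R ?z t) (at t)" for t
        by (auto intro!: derivative_eq_intros dx dLx simp: LL D algebra_simps)
      ultimately have "?z 0 = 0"
        using bounded_exponential_zero [of ?z \<kappa>] \<open>\<kappa> \<noteq> 0\<close> by blast
      then show ?thesis using x(1) by (simp add: eq_neg_iff_add_eq_0)
    qed
    have "\<alpha> = - \<kappa>" "\<delta> = - \<kappa>"
      using eig [of "(1, 0)"] eig [of "(0, 1)"] by (simp_all add: co zero_prod_def)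
    then show False using \<open>\<alpha> + \<delta> = 0\<close> \<open>\<kappa> \<noteq> 0\<close> by simp
  qed
  show thesis
  proof (rule that [of L "sqrt D"])
    show "L (L u) = - ((sqrt D)\<^sup>2) *\<^sub>R u" for u using LL \<open>D > 0\<close> by simp
  qed (use \<open>D > 0\<close> \<open>linear L\<close> f in auto)
qed

text \<open>Uniqueness needs no general theory: rotating a solution backwards in time by the explicit
  formula yields a curve with zero derivative.\<close>

lemma center_flow:
  assumes "linear L" and "\<omega> > 0" and LL: "\<And>u. L (L u) = - (\<omega>\<^sup>2) *\<^sub>R u"
    and f: "f = (\<lambda>p. L (p - c))"
  shows "flow f p t = c + cos (\<omega> * t) *\<^sub>R (p - c) + (sin (\<omega> * t) / \<omega>) *\<^sub>R L (p - c)"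
proof -
  interpret linear L by fact
  have bl: "bounded_linear L" using linear_conv_bounded_linear \<open>linear L\<close> by blast
  define X where
    "X = (\<lambda>t. c + cos (\<omega> * t) *\<^sub>R (p - c) + (sin (\<omega> * t) / \<omega>) *\<^sub>R L (p - c))"
  have "is_solution f p X"
    unfolding is_solution_def
  proof (intro conjI allI)
    show "X 0 = p" by (simp add: X_def)
    show "(X has_vector_derivative f (X t)) (at t)" for t
      unfolding X_def f using \<open>\<omega> > 0\<close>
      by (auto intro!: derivative_eq_intros simp: add diff scale LL power2_eq_square algebra_simps)
  qed
  moreover have "x = X" if "is_solution f p x" for x
  proof
    fix t
    define u where "u = (\<lambda>s. x s - c)"
    have u0: "u 0 = p - c" using that by (simp add: u_def is_solution_def)
    have du: "(u has_vector_derivative L (u s)) (at s)" for s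
      using that unfolding is_solution_def u_def f
      by (auto intro!: derivative_eq_intros)
    have dLu: "((\<lambda>s. L (u s)) has_vector_derivative L (L (u s))) (at s)" for s
      using bounded_linear.has_vector_derivative [OF bl du] .
    let ?w = "\<lambda>s. cos (\<omega> * s) *\<^sub>R u s - (sin (\<omega> * s) / \<omega>) *\<^sub>R L (u s)"
    have "(?w has_vector_derivative 0) (at s)" for s
      using \<open>\<omega> > 0\<close>
      by (auto intro!: derivative_eq_intros du dLu simp: LL power2_eq_square algebra_simps)
    then obtain w where w: "\<And>s. ?w s = w"
      using has_vector_derivative_zero_constant [of UNIV ?w] by auto
    have w0: "w = p - c" using w [of 0] by (simp add: u0)
    \<comment> \<open>rotating the constant curve forwards again recovers the solution\<close>
    have "cos (\<omega> * t) *\<^sub>R w + (sin (\<omega> * t) / \<omega>) *\<^sub>R L w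
        = ((cos (\<omega> * t))\<^sup>2 + (sin (\<omega> * t))\<^sup>2) *\<^sub>R u t"
      using \<open>\<omega> > 0\<close>
      by (simp add: w [of t, symmetric] diff scale LL power2_eq_square algebra_simps
          flip: scaleR_add_left)
    then have "u t = cos (\<omega> * t) *\<^sub>R (p - c) + (sin (\<omega> * t) / \<omega>) *\<^sub>R L (p - c)"
      by (simp add: w0)
    then show "x t = X t" by (simp add: u_def X_def algebra_simps)
  qed
  ultimately have "flow f p = X"
    unfolding flow_def by (rule the_equality)
  then show ?thesis by (simp add: X_def)
qed

text \<open>The first coordinate is written with half angles because the factor \<open>sin (\<omega> * t / 2)\<close>
  splits off the trivial zeros, at multiples of the period. If the coefficient \<open>\<beta>\<close> vanished, the
  direction of the line would be a real eigenvector of the linear part, whose square is negative.\<close>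

lemma center_flow_from_line:
  assumes "affine_field f" and "is_center f c"
  obtains \<omega> \<beta> m where "\<omega> > 0" "\<beta> \<noteq> 0"
    "\<And>y. fst (f (0, y)) = \<beta> * (y - m)"
    "\<And>y t. fst (flow f (0, y) t) =
        2 * sin (\<omega> * t / 2) * (fst c * sin (\<omega> * t / 2) + fst (f (0, y)) / \<omega> * cos (\<omega> * t / 2))"
    "\<And>y t. fst (f (flow f (0, y) t)) = fst (f (0, y)) * cos (\<omega> * t) + \<omega> * fst c * sin (\<omega> * t)"
proof -
  obtain L \<omega> where "linear L" "\<omega> > 0" and LL: "\<And>u. L (L u) = - (\<omega>\<^sup>2) *\<^sub>R u"
    and f: "f = (\<lambda>p. L (p - c))"
    using center_normal_form [OF assms] by blast
  interpret linear L by fact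
  obtain \<alpha> \<beta> \<gamma> \<delta> where co: "\<And>p. L p = (\<alpha> * fst p + \<beta> * snd p, \<gamma> * fst p + \<delta> * snd p)"
    using linear_plane_coordinates [OF \<open>linear L\<close>] by blast
  note flow = center_flow [OF \<open>linear L\<close> \<open>\<omega> > 0\<close> LL f]
  have "\<beta> \<noteq> 0"
  proof
    assume "\<beta> = 0"
    then have "\<delta> * \<delta> = - \<omega>\<^sup>2" using LL [of "(0, 1)"] by (simp add: co)
    then show False using \<open>\<omega> > 0\<close> by (metis neg_equal_zero not_square_less_zero
        neg_less_0_iff_less zero_less_power)
  qed
  show thesis
  proof (rule that [OF \<open>\<omega> > 0\<close> \<open>\<beta> \<noteq> 0\<close>, of "snd c + \<alpha> * fst c / \<beta>"])
    show "fst (f (0, y)) = \<beta> * (y - (snd c + \<alpha> * fst c / \<beta>))" for y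
      using \<open>\<beta> \<noteq> 0\<close> by (simp add: f co algebra_simps)
    fix y t
    have half: "cos (\<omega> * t) = 1 - 2 * (sin (\<omega> * t / 2))\<^sup>2"
      "sin (\<omega> * t) = 2 * sin (\<omega> * t / 2) * cos (\<omega> * t / 2)"
      using cos_double_sin [of "\<omega> * t / 2"] sin_double [of "\<omega> * t / 2"] by simp_all
    have "fst (flow f (0, y) t) =
        fst c * (1 - cos (\<omega> * t)) + fst (f (0, y)) / \<omega> * sin (\<omega> * t)"
      by (simp add: flow) (simp add: f algebra_simps)
    then show "fst (flow f (0, y) t) =
        2 * sin (\<omega> * t / 2) * (fst c * sin (\<omega> * t / 2) + fst (f (0, y)) / \<omega> * cos (\<omega> * t / 2))"
      by (simp only: half) (simp add: power2_eq_square algebra_simps)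
    show "fst (f (flow f (0, y) t)) = fst (f (0, y)) * cos (\<omega> * t) + \<omega> * fst c * sin (\<omega> * t)"
      using \<open>\<omega> > 0\<close> unfolding flow
      by (simp add: f add scale LL power2_eq_square)
  qed
qed

section \<open>The half-plane maps are reflections of half-lines\<close>

lemma first_zero_sin_cos:
  fixes a b :: real
  assumes "a \<noteq> 0 \<or> b \<noteq> 0"
  obtains s where "0 < s" "s \<le> pi" "a * sin s + b * cos s = 0"
    "\<And>r. 0 < r \<Longrightarrow> r < s \<Longrightarrow> a * sin r + b * cos r \<noteq> 0"
proof (cases "b = 0")
  case True
  then show ?thesis
    using assms sin_gt_zero by (intro that [of pi]) force+
next
  case False
  define s where "s = pi / 2 + arctan (a / b)"
  have s: "0 < s" "s < pi"
    using arctan_lbound [of "a / b"] arctan_ubound [of "a / b"] by (auto simp: s_def)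
  have zero: "a * sin s + b * cos s = 0"
    using False by (simp add: s_def sin_add cos_add sin_arctan cos_arctan)
  have "a * sin r + b * cos r \<noteq> 0" if "0 < r" "r < s" for r
  proof
    assume r: "a * sin r + b * cos r = 0"
    have "b * sin (s - r) = sin s * (a * sin r + b * cos r) - sin r * (a * sin s + b * cos s)"
      by (simp add: sin_diff algebra_simps)
    then have "sin (s - r) = 0" using r zero False by simp
    then show False using sin_gt_zero [of "s - r"] that s by simp
  qed
  with s zero show ?thesis by (intro that [of s]) auto
qed

text \<open>Whether the endpoint \<open>m\<close> satisfies \<open>E\<close> is left open: an orbit tangent to the line at \<open>m\<close>
  enters the half-plane exactly if the center lies in it. Both branches for \<open>h\<close> agree at \<open>m\<close>.\<close>

definition reflects_half_line ::
    "(real \<Rightarrow> bool) \<Rightarrow> (real \<Rightarrow> real) \<Rightarrow> real \<Rightarrow> real \<Rightarrow> bool" where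
  "reflects_half_line E h k m \<longleftrightarrow> k \<noteq> 0 \<and>
     (\<forall>y. 0 < k * (y - m) \<longrightarrow> E y) \<and> (\<forall>y. E y \<longrightarrow> 0 \<le> k * (y - m)) \<and>
     (\<forall>y. h y = (if E y then 2 * m - y else y))"

text \<open>The orbit stays off the line until the first positive zero of the factor \<open>q\<close>, when
  the horizontal component of the velocity is opposite to the initial one. As that component is an affine function of the
  position on the line with zero \<open>m\<close>, the return point is the mirror image of the starting
  point. A tangent orbit fits the same description: its first zero is the full period.\<close>

lemma center_half_map_reflects:
  assumes "affine_field f" and "is_center f c" and "\<sigma> \<noteq> 0"
  obtains k m where "\<And>y. fst (f (0, y)) = 0 \<longleftrightarrow> y = m"
    "reflects_half_line (enters f {p. 0 < \<sigma> * fst p}) (half_map f {p. 0 < \<sigma> * fst p}) k m"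
proof -
  obtain \<omega> \<beta> m where "\<omega> > 0" "\<beta> \<noteq> 0" and field: "\<And>y. fst (f (0, y)) = \<beta> * (y - m)"
    and x: "\<And>y t. fst (flow f (0, y) t) = 2 * sin (\<omega> * t / 2) *
          (fst c * sin (\<omega> * t / 2) + fst (f (0, y)) / \<omega> * cos (\<omega> * t / 2))"
    and dx: "\<And>y t. fst (f (flow f (0, y) t)) =
          fst (f (0, y)) * cos (\<omega> * t) + \<omega> * fst c * sin (\<omega> * t)"
    using center_flow_from_line [OF assms(1,2)] by metis
  define q where
    "q y t = fst c * sin (\<omega> * t / 2) + fst (f (0, y)) / \<omega> * cos (\<omega> * t / 2)" for y t
  have x: "fst (flow f (0, y) t) = 2 * sin (\<omega> * t / 2) * q y t" for y t
    unfolding x q_def ..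
  have sin_pos: "0 < sin (\<omega> * t / 2)" if "0 < t" "t < 2 * pi / \<omega>" for t
    using that \<open>\<omega> > 0\<close> by (intro sin_gt_zero) (auto simp: field_simps)
  have small: "\<forall>\<^sub>F t in at_right 0. 0 < t \<and> t < 2 * pi / \<omega>"
    using \<open>\<omega> > 0\<close> by (intro eventually_at_rightI [of 0 "2 * pi / \<omega>"]) auto
  have enters_q: "enters f {p. 0 < \<sigma> * fst p} y \<longleftrightarrow> (\<forall>\<^sub>F t in at_right 0. 0 < \<sigma> * q y t)" for y
    unfolding enters_def
  proof (rule eventually_subst, rule eventually_mono [OF small])
    fix t assume "0 < t \<and> t < 2 * pi / \<omega>"
    then have "0 < 2 * sin (\<omega> * t / 2)" using sin_pos by simp
    then have "0 < 2 * sin (\<omega> * t / 2) * (\<sigma> * q y t) \<longleftrightarrow> 0 < \<sigma> * q y t"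
      using zero_less_mult_pos mult_pos_pos by blast
    moreover have "2 * sin (\<omega> * t / 2) * (\<sigma> * q y t) = \<sigma> * fst (flow f (0, y) t)"
      by (simp add: x)
    ultimately show "(flow f (0, y) t \<in> {p. 0 < \<sigma> * fst p}) = (0 < \<sigma> * q y t)"
      by simp
  qed
  have lim: "((\<lambda>t. \<sigma> * q y t) \<longlongrightarrow> \<sigma> * (fst (f (0, y)) / \<omega>)) (at_right 0)" for y
    unfolding q_def using \<open>\<omega> > 0\<close> by (auto intro!: tendsto_eq_intros)
  have E_open: "enters f {p. 0 < \<sigma> * fst p} y" if "0 < (\<sigma> * \<beta>) * (y - m)" for y
  proof -
    have "0 < \<sigma> * (fst (f (0, y)) / \<omega>)"
      using that \<open>\<omega> > 0\<close> by (simp add: field mult.assoc)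
    then show ?thesis unfolding enters_q using order_tendstoD(1) [OF lim] by blast
  qed
  have E_closed: "0 \<le> (\<sigma> * \<beta>) * (y - m)" if E: "enters f {p. 0 < \<sigma> * fst p} y" for y
  proof (rule ccontr)
    assume "\<not> 0 \<le> (\<sigma> * \<beta>) * (y - m)"
    then have "\<sigma> * (fst (f (0, y)) / \<omega>) < 0"
      using \<open>\<omega> > 0\<close> by (simp add: field mult.assoc divide_less_0_iff)
    then have "\<forall>\<^sub>F t in at_right 0. \<sigma> * q y t < 0" using order_tendstoD(2) [OF lim] by blast
    then have "\<forall>\<^sub>F t in at_right (0::real). False"
      using E [unfolded enters_q] by eventually_elim simp
    then show False by simp
  qed
  have reflect: "half_map f {p. 0 < \<sigma> * fst p} y = 2 * m - y"
    if E: "enters f {p. 0 < \<sigma> * fst p} y" for y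
  proof -
    have "fst c \<noteq> 0 \<or> fst (f (0, y)) / \<omega> \<noteq> 0"
    proof (rule ccontr)
      assume "\<not> (fst c \<noteq> 0 \<or> fst (f (0, y)) / \<omega> \<noteq> 0)"
      then have "\<forall>\<^sub>F t in at_right (0::real). False"
        using E [unfolded enters_q] \<open>\<omega> > 0\<close> by (auto simp: q_def)
      then show False by simp
    qed
    then obtain s where s: "0 < s" "s \<le> pi"
      and zero: "fst c * sin s + fst (f (0, y)) / \<omega> * cos s = 0"
      and first: "\<And>r. 0 < r \<Longrightarrow> r < s \<Longrightarrow> fst c * sin r + fst (f (0, y)) / \<omega> * cos r \<noteq> 0"
      by (rule first_zero_sin_cos) (rule that)
    define T where "T = 2 * s / \<omega>"
    have T: "\<omega> * T / 2 = s" "0 < T" using \<open>\<omega> > 0\<close> s by (auto simp: T_def)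
    have on_line: "fst (flow f (0, y) T) = 0" using zero by (simp add: x q_def T)
    have "return_time f y = T"
      unfolding return_time_def
    proof (rule Least_equality)
      show "0 < T \<and> flow f (0, y) T \<in> Sigma_line"
        using T on_line by (simp add: Sigma_line_def)
      fix t assume t: "0 < t \<and> flow f (0, y) t \<in> Sigma_line"
      show "T \<le> t"
      proof (rule ccontr)
        assume "\<not> T \<le> t"
        then have r: "0 < \<omega> * t / 2" "\<omega> * t / 2 < s"
          using t \<open>\<omega> > 0\<close> by (auto simp: T_def field_simps)
        then have "sin (\<omega> * t / 2) \<noteq> 0" using sin_gt_zero [of "\<omega> * t / 2"] s by simp
        then show False
          using t first [OF r] by (simp add: Sigma_line_def x q_def)
      qed
    qed
    moreover have "snd (flow f (0, y) T) = 2 * m - y"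
    proof -
      let ?y' = "snd (flow f (0, y) T)" and ?v = "fst (f (0, y))"
      have \<omega>c: "\<omega> * fst c * sin s = - ?v * cos s" using zero \<open>\<omega> > 0\<close> by (simp add: field_simps)
      have "\<omega> * T = 2 * s" using T by simp
      then have "fst (f (flow f (0, y) T)) = ?v * cos (2 * s) + 2 * (\<omega> * fst c * sin s) * cos s"
        by (simp add: dx sin_double)
      also have "\<dots> = - ?v"
        unfolding \<omega>c cos_double_cos by (simp add: power2_eq_square algebra_simps)
      finally have "fst (f (0, ?y')) = - ?v"
        using on_line by (metis prod.collapse)
      then have "\<beta> * (?y' - m) = \<beta> * (m - y)" by (simp add: field algebra_simps)
      then show ?thesis using \<open>\<beta> \<noteq> 0\<close> by simp
    qed
    ultimately show ?thesis using E by (simp add: half_map_def)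
  qed
  show thesis
  proof (rule that [of m "\<sigma> * \<beta>"])
    show "fst (f (0, y)) = 0 \<longleftrightarrow> y = m" for y using \<open>\<beta> \<noteq> 0\<close> by (simp add: field)
    show "reflects_half_line (enters f {p. 0 < \<sigma> * fst p}) (half_map f {p. 0 < \<sigma> * fst p})
        (\<sigma> * \<beta>) m"
      unfolding reflects_half_line_def
      using E_open E_closed reflect \<open>\<sigma> \<noteq> 0\<close> \<open>\<beta> \<noteq> 0\<close> by (auto simp: half_map_def)
  qed
qed

section \<open>The return map near a regular cycle\<close>

text \<open>Increments \<open>r ^ k * d\<close> with \<open>r \<ge> 0\<close> have the sign of \<open>d\<close>, so their sum can only vanish
  if \<open>d\<close> does.\<close>

lemma sequence_with_geometric_increments:
  fixes u :: "nat \<Rightarrow> real"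
  assumes step: "\<And>k. u (Suc (Suc k)) - u (Suc k) = r * (u (Suc k) - u k)"
    and "r \<ge> 0" and "m \<ge> 1" and "u m = u 0"
  shows "u (Suc 0) = u 0"
proof -
  define d where "d = u (Suc 0) - u 0"
  have inc: "u (Suc k) - u k = r ^ k * d" for k
    by (induction k) (simp_all add: step d_def [symmetric])
  have "0 = (\<Sum>k<m. u (Suc k) - u k)"
    using \<open>u m = u 0\<close> by (subst sum_lessThan_telescope) simp
  also have "\<dots> = (\<Sum>k<m. r ^ k) * d"
    by (simp only: inc sum_distrib_right)
  finally have "(\<Sum>k<m. r ^ k) * d = 0" ..
  moreover have "(\<Sum>k<m. r ^ k) \<ge> r ^ 0"
    using \<open>r \<ge> 0\<close> \<open>m \<ge> 1\<close> by (intro member_le_sum) auto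
  ultimately have "d = 0" by auto
  then show ?thesis by (simp add: d_def)
qed

text \<open>At an interior point of the half-line every direction \<open>\<tau>\<close> stays inside, while at the endpoint
  \<open>\<tau>\<close> has to point inwards.\<close>

lemma reflects_half_line_one_sided:
  assumes "reflects_half_line E h k m" and "E y" and "y \<noteq> m \<or> 0 < k * \<tau>"
  shows "\<forall>\<^sub>F \<epsilon> in at_right 0. E (y + \<tau> * \<epsilon>)"
proof -
  have E_open: "\<And>y. 0 < k * (y - m) \<Longrightarrow> E y" and "0 \<le> k * (y - m)" "k \<noteq> 0"
    using assms(1,2) by (auto simp: reflects_half_line_def)
  have "\<forall>\<^sub>F \<epsilon> in at_right 0. 0 < k * (y + \<tau> * \<epsilon> - m)"
  proof (cases "y = m")
    case True
    then have "0 < k * \<tau>" using assms(3) by blast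
    then have "0 < k * (y + \<tau> * \<epsilon> - m)" if "0 < \<epsilon>" for \<epsilon>
      using that True mult_pos_pos [of "k * \<tau>" \<epsilon>] by (simp add: mult.assoc)
    then show ?thesis using eventually_at_right_less [of 0] by (auto elim: eventually_mono)
  next
    case False
    then have "0 < k * (y - m)" 
      using \<open>0 \<le> k * (y - m)\<close> \<open>k \<noteq> 0\<close> by (simp add: order_less_le)
    moreover have "((\<lambda>\<epsilon>. k * (y + \<tau> * \<epsilon> - m)) \<longlongrightarrow> k * (y - m)) (at_right 0)"
      by (auto intro!: tendsto_eq_intros)
    ultimately show ?thesis using order_tendstoD(1) by blast
  qed
  then show ?thesis by (rule eventually_mono) (rule E_open)
qed

lemma degree_one_reset:
  assumes "degree (p :: real poly) = 1"
  obtains a b where "a \<noteq> 0" "poly p = (\<lambda>y. a * y + b)" "deriv (poly p) 0 = a"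
proof -
  obtain a b where p: "p = [:b, a:]" "a \<noteq> 0"
    using assms degree1_coeffs by metis
  then have "poly p = (\<lambda>y. a * y + b)" by (auto simp: algebra_simps)
  moreover have "deriv (\<lambda>y. a * y + b) 0 = a"
    by (rule DERIV_imp_deriv) (auto intro!: derivative_eq_intros)
  ultimately show thesis using that p(2) by metis
qed

locale hybrid_reflections =
  fixes X :: hybrid_system and a b k1 m1 k2 m2 :: real
  assumes a_nonzero: "a \<noteq> 0"
    and reset: "poly (reset X) = (\<lambda>y. a * y + b)"
    and reflects1: "reflects_half_line (enters (field1 X) A1) (half_map (field1 X) A1) k1 m1"
    and reflects2: "reflects_half_line (enters (field2 X) A2) (half_map (field2 X) A2) k2 m2"
begin

definition regular_at :: "real \<Rightarrow> bool" where
  "regular_at y \<longleftrightarrow> enters (field1 X) A1 y \<and> enters (field2 X) A2 (mid_point X y)"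

lemma half_map1: "half_map (field1 X) A1 y = (if enters (field1 X) A1 y then 2 * m1 - y else y)"
  using reflects1 by (simp add: reflects_half_line_def)

lemma half_map2: "half_map (field2 X) A2 y = (if enters (field2 X) A2 y then 2 * m2 - y else y)"
  using reflects2 by (simp add: reflects_half_line_def)

lemma mid_point_enters:
  "enters (field1 X) A1 y \<Longrightarrow> mid_point X y = a * (2 * m1 - y) + b"
  by (simp add: mid_point_def reset half_map1)

lemma return_map_regular:
  assumes "regular_at y"
  shows "return_map X y = a\<^sup>2 * y + (2 * a * (m2 - a * m1) - a * b + b)"
proof -
  have "return_map X y = a * (2 * m2 - mid_point X y) + b"
    using assms by (simp add: regular_at_def return_map_def reset half_map2)
  also have "mid_point X y = a * (2 * m1 - y) + b"
    using assms mid_point_enters [of y] by (simp add: regular_at_def)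
  finally show ?thesis by (simp add: power2_eq_square algebra_simps)
qed

lemma regular_cycle_regular_at:
  "regular_limit_cycle X y \<Longrightarrow> regular_at ((return_map X ^^ k) y)"
  by (simp add: regular_limit_cycle_def regular_at_def)

lemma regular_cycle_fixed_point:
  assumes "regular_limit_cycle X y"
  shows "return_map X y = y"
proof -
  have "y \<in> periodic_points X"
    using assms by (simp add: regular_limit_cycle_def limit_cycle_def isolated_in_def)
  then obtain m where m: "m \<ge> 1" "(return_map X ^^ m) y = y" 
    by (auto simp: periodic_points_def)
  let ?u = "\<lambda>k. (return_map X ^^ k) y"
  have "?u (Suc 0) = ?u 0"
  proof (rule sequence_with_geometric_increments [of ?u "a\<^sup>2"])
    fix k
    show "?u (Suc (Suc k)) - ?u (Suc k) = a\<^sup>2 * (?u (Suc k) - ?u k)"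
      using return_map_regular [OF regular_cycle_regular_at [OF assms, of k]]
        return_map_regular [OF regular_cycle_regular_at [OF assms, of "Suc k"]]
      by (simp add: algebra_simps)
  qed (use m in auto)
  then show ?thesis by simp
qed

lemma regular_cycle_period:
  assumes "regular_limit_cycle X y"
  shows "cycle_period X y = 1"
  unfolding cycle_period_def
  by (rule Least_equality) (simp_all add: regular_cycle_fixed_point [OF assms])

text \<open>The half-plane map of the first field reverses directions where the half-plane is entered, so a
  displacement \<open>\<tau>\<close> of a regular point becomes \<open>- a * \<tau>\<close> at the middle point. If at most one of the two points is a
  tangency, \<open>\<tau>\<close> can be chosen to satisfy the one remaining sign condition. At a double tangency
  the conditions \<open>0 < k1 * \<tau>\<close> and \<open>0 < k2 * (- a * \<tau>)\<close> may contradict each other; then the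
  direction leaving the first half-line, along which the middle point is displaced
  by \<open>a * \<tau>\<close> with no reflection, leaves the second half-line as well.\<close>

lemma one_sided_regular_or_neutral:
  assumes "regular_at y"
  obtains \<tau> where "\<tau> \<noteq> 0"
      "\<forall>\<^sub>F \<epsilon> in at_right 0. regular_at (y + \<tau> * \<epsilon>)"
  | \<tau> where "\<tau> \<noteq> 0" "y = m1" "mid_point X y = m2"
      "\<forall>\<^sub>F \<epsilon> in at_right 0. \<not> enters (field1 X) A1 (y + \<tau> * \<epsilon>) \<and>
         \<not> enters (field2 X) A2 (mid_point X (y + \<tau> * \<epsilon>))"
proof -
  let ?z = "mid_point X y"
  have E1: "enters (field1 X) A1 y" and E2: "enters (field2 X) A2 ?z"
    using assms by (auto simp: regular_at_def)
  have "k1 \<noteq> 0" "k2 \<noteq> 0"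
    using reflects1 reflects2 by (auto simp: reflects_half_line_def)
  have regular: "\<forall>\<^sub>F \<epsilon> in at_right 0. regular_at (y + \<tau> * \<epsilon>)"
    if "y \<noteq> m1 \<or> 0 < k1 * \<tau>" "?z \<noteq> m2 \<or> 0 < k2 * (- a * \<tau>)" for \<tau>
    using reflects_half_line_one_sided [OF reflects1 E1 that(1)]
      reflects_half_line_one_sided [OF reflects2 E2 that(2)]
  proof eventually_elim
    case (elim \<epsilon>)
    have "mid_point X (y + \<tau> * \<epsilon>) = ?z + - a * \<tau> * \<epsilon>"
      using mid_point_enters [OF E1] mid_point_enters [OF elim(1)] by (simp add: algebra_simps)
    with elim show ?case by (simp add: regular_at_def)
  qed
  consider "?z \<noteq> m2" | "?z = m2" "y \<noteq> m1" | "?z = m2" "y = m1" "0 < k1 * (- a * k2)"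
    | "?z = m2" "y = m1" "k1 * (- a * k2) < 0"
    using \<open>k1 \<noteq> 0\<close> \<open>k2 \<noteq> 0\<close> a_nonzero by (metis linorder_neqE_linordered_idom mult_eq_0_iff
        neg_equal_0_iff_equal)
  then show thesis
  proof cases
    case 1
    then show ?thesis
      using that(1) [OF \<open>k1 \<noteq> 0\<close> regular [of k1]] \<open>k1 \<noteq> 0\<close>
      by (auto simp: zero_less_mult_iff neq_iff)
  next
    case 2
    have "k2 * (- a * (- a * k2)) = (a * k2)\<^sup>2" by (simp add: power2_eq_square)
    then have "0 < k2 * (- a * (- a * k2))" using \<open>k2 \<noteq> 0\<close> a_nonzero by simp
    then show ?thesis
      using that(1) [OF _ regular [of "- a * k2"]] 2 \<open>k2 \<noteq> 0\<close> a_nonzero by simp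
  next
    case 3
    then show ?thesis
      using that(1) [OF \<open>k1 \<noteq> 0\<close> regular [of k1]] \<open>k1 \<noteq> 0\<close>
      by (auto simp: zero_less_mult_iff mult_less_0_iff)
  next
    case 4
    have out: "\<not> enters (field1 X) A1 (y + - k1 * \<epsilon>) \<and>
        \<not> enters (field2 X) A2 (mid_point X (y + - k1 * \<epsilon>))" if "0 < \<epsilon>" for \<epsilon>
    proof -
      have "k1 * (y + - k1 * \<epsilon> - m1) = - (k1\<^sup>2 * \<epsilon>)" 
        using 4 by (simp add: power2_eq_square)
      also have "\<dots> < 0" using that \<open>k1 \<noteq> 0\<close> by simp
      finally have E1': "\<not> enters (field1 X) A1 (y + - k1 * \<epsilon>)"
        using reflects1 by (auto simp: reflects_half_line_def not_less [symmetric])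
      have "a * m1 + b = m2" using mid_point_enters [OF E1] 4 by simp
      then have "k2 * (mid_point X (y + - k1 * \<epsilon>) - m2) = (k1 * (- a * k2)) * \<epsilon>"
        using E1' 4 by (simp add: mid_point_def reset half_map1 algebra_simps)
      also have "\<dots> < 0" using 4 that by (simp add: mult_less_0_iff)
      finally have "\<not> enters (field2 X) A2 (mid_point X (y + - k1 * \<epsilon>))"
        using reflects2 by (auto simp: reflects_half_line_def not_less [symmetric])
      with E1' show ?thesis ..
    qed
    show ?thesis
      by (rule that(2) [of "- k1"])
        (use 4 \<open>k1 \<noteq> 0\<close> out eventually_at_right_less [of "0::real"] in \<open>auto elim: eventually_mono\<close>)
  qed
qed

text \<open>A slope of absolute value one would surround the cycle, on at least one side, by fixed points
  of the return map: either the formula at regular points is the identity, or the cycle is a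
  double tangency, where the reset map applied twice fixes \<open>y\<close> and has slope one.\<close>

lemma regular_cycle_slope:
  assumes "regular_limit_cycle X y"
  shows "a\<^sup>2 \<noteq> 1"
proof
  assume a: "a\<^sup>2 = 1"
  have fixed: "return_map X y = y" by (rule regular_cycle_fixed_point) fact
  have reg: "regular_at y" using regular_cycle_regular_at [OF assms, of 0] by simp
  have "\<exists>\<tau>. \<tau> \<noteq> 0 \<and> (\<forall>\<^sub>F \<epsilon> in at_right 0. return_map X (y + \<tau> * \<epsilon>) = y + \<tau> * \<epsilon>)"
  proof (rule one_sided_regular_or_neutral [OF reg])
    fix \<tau> assume "\<tau> \<noteq> 0" and ev: "\<forall>\<^sub>F \<epsilon> in at_right 0. regular_at (y + \<tau> * \<epsilon>)"
    from ev have "\<forall>\<^sub>F \<epsilon> in at_right 0. return_map X (y + \<tau> * \<epsilon>) = y + \<tau> * \<epsilon>"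
    proof eventually_elim
      case (elim \<epsilon>)
      show ?case
        using return_map_regular [OF elim] return_map_regular [OF reg] fixed a by simp
    qed
    then show ?thesis using \<open>\<tau> \<noteq> 0\<close> by blast
  next
    fix \<tau> assume "\<tau> \<noteq> 0" and tangent: "y = m1" "mid_point X y = m2"
      and ev: "\<forall>\<^sub>F \<epsilon> in at_right 0. \<not> enters (field1 X) A1 (y + \<tau> * \<epsilon>) \<and>
         \<not> enters (field2 X) A2 (mid_point X (y + \<tau> * \<epsilon>))"
    have "a * y + b = m2"
      using tangent mid_point_enters [of y] reg by (simp add: regular_at_def)
    moreover have "a * m2 + b = y"
      using fixed by (simp only: return_map_def tangent(2)) (simp add: reset half_map2 split: if_splits)
    ultimately have invol: "a * (a * y + b) + b = y" by simp
    from ev have "\<forall>\<^sub>F \<epsilon> in at_right 0. return_map X (y + \<tau> * \<epsilon>) = y + \<tau> * \<epsilon>"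
    proof eventually_elim
      case (elim \<epsilon>)
      then have "mid_point X (y + \<tau> * \<epsilon>) = a * (y + \<tau> * \<epsilon>) + b"
        by (simp add: mid_point_def reset half_map1)
      with elim have "return_map X (y + \<tau> * \<epsilon>) = a * (a * (y + \<tau> * \<epsilon>) + b) + b"
        by (simp add: return_map_def reset half_map2)
      also have "\<dots> = a * (a * y + b) + b + a\<^sup>2 * (\<tau> * \<epsilon>)"
        by (simp add: power2_eq_square algebra_simps)
      finally show ?case by (simp add: invol a)
    qed
    then show ?thesis using \<open>\<tau> \<noteq> 0\<close> by blast
  qed
  then obtain \<tau> where "\<tau> \<noteq> 0"
    and ev: "\<forall>\<^sub>F \<epsilon> in at_right 0. return_map X (y + \<tau> * \<epsilon>) = y + \<tau> * \<epsilon>"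
    by blast
  obtain T where "open T" and T: "T \<inter> periodic_points X = {y}"
    using assms by (auto simp: regular_limit_cycle_def limit_cycle_def isolated_in_def)
  have "((\<lambda>\<epsilon>. y + \<tau> * \<epsilon>) \<longlongrightarrow> y) (at_right 0)" by (auto intro!: tendsto_eq_intros)
  then have "\<forall>\<^sub>F \<epsilon> in at_right 0. y + \<tau> * \<epsilon> \<in> T"
    using \<open>open T\<close> T by (intro topological_tendstoD) auto
  then have "\<forall>\<^sub>F \<epsilon> in at_right (0::real). False"
    using ev eventually_at_right_less [of "0::real"]
  proof eventually_elim
    case (elim \<epsilon>)
    have "y + \<tau> * \<epsilon> \<in> periodic_points X"
      unfolding periodic_points_def using elim(2) by (auto intro!: exI [of _ 1])
    then have "y + \<tau> * \<epsilon> = y" using elim(1) T by blast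
    then show False using \<open>\<tau> \<noteq> 0\<close> elim(3) by simp
  qed
  then show False by simp
qed

lemma regular_cycle_unique:
  assumes "regular_limit_cycle X y" and "regular_limit_cycle X z"
  shows "y = z"
proof -
  have fixed: "u = a\<^sup>2 * u + (2 * a * (m2 - a * m1) - a * b + b)" 
    if "regular_limit_cycle X u" for u
    using return_map_regular [of u] regular_cycle_regular_at [OF that, of 0]
      regular_cycle_fixed_point [OF that] by simp
  have "(1 - a\<^sup>2) * (y - z) = 0"
    using fixed [OF assms(1)] fixed [OF assms(2)] by (simp add: algebra_simps)
  then show ?thesis using regular_cycle_slope [OF assms(1)] by simp
qed

lemma displacement_derivative:
  assumes "regular_at y" and "y \<noteq> m1" and "mid_point X y \<noteq> m2"
  shows "(displacement X has_real_derivative a\<^sup>2 - 1) (at y)"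
proof -
  have E1: "enters (field1 X) A1 y" and E2: "enters (field2 X) A2 (mid_point X y)"
    using assms(1) by (auto simp: regular_at_def)
  have pos: "0 < k1 * (y - m1)" "0 < k2 * (a * (2 * m1 - y) + b - m2)"
    using reflects1 reflects2 E1 E2 assms(2,3)
    unfolding reflects_half_line_def order_less_le mid_point_enters [OF E1] by auto
  have "\<forall>\<^sub>F u in nhds y. 0 < k1 * (u - m1)" 
    using pos(1) by (intro order_tendstoD(1)) (auto intro!: tendsto_eq_intros filterlim_ident)
  moreover have "\<forall>\<^sub>F u in nhds y. 0 < k2 * (a * (2 * m1 - u) + b - m2)"
    using pos(2) by (intro order_tendstoD(1)) (auto intro!: tendsto_eq_intros filterlim_ident)
  ultimately have "\<forall>\<^sub>F u in nhds y. displacement X u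
      = a\<^sup>2 * u + (2 * a * (m2 - a * m1) - a * b + b) - u"
  proof eventually_elim
    case (elim u)
    then have "enters (field1 X) A1 u" using reflects1 by (simp add: reflects_half_line_def)
    then have "regular_at u"
      using elim(2) reflects2 mid_point_enters [of u]
      by (simp add: regular_at_def reflects_half_line_def)
    then show ?case by (simp add: displacement_def return_map_regular)
  qed
  moreover have "((\<lambda>u. a\<^sup>2 * u + (2 * a * (m2 - a * m1) - a * b + b) - u)
      has_real_derivative a\<^sup>2 - 1) (at y)"
    by (auto intro!: derivative_eq_intros)
  ultimately show ?thesis by (subst DERIV_cong_ev [OF refl _ refl])
qed

end

theorem theorem2:
  fixes X :: hybrid_system
  assumes "X \<in> hybrid_class 1"
    and "\<exists>y. regular_limit_cycle X y"
  shows "\<bar>deriv (poly (reset X)) 0\<bar> \<noteq> 1 \<and>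
    (\<exists>!y. regular_limit_cycle X y) \<and>
    (\<forall>y. regular_limit_cycle X y \<longrightarrow>
       cycle_period X y = 1 \<and>
       (crosses_transversally X y \<longrightarrow>
          hyperbolic X y \<and>
          (\<bar>deriv (poly (reset X)) 0\<bar> < 1 \<longrightarrow> stable_cycle X y) \<and>
          (\<bar>deriv (poly (reset X)) 0\<bar> > 1 \<longrightarrow> unstable_cycle X y)))"
proof -
  obtain c1 c2 where centers: "affine_field (field1 X)" "is_center (field1 X) c1"
      "affine_field (field2 X)" "is_center (field2 X) c2"
    and "degree (reset X) = 1"
    using assms(1) by (auto simp: hybrid_class_def)
  obtain a b where "a \<noteq> 0" and reset: "poly (reset X) = (\<lambda>y. a * y + b)"
    and a: "deriv (poly (reset X)) 0 = a"
    using degree_one_reset [OF \<open>degree (reset X) = 1\<close>] by metis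
  have sides: "A1 = {p. 0 < - 1 * fst p}" "A2 = {p. 0 < 1 * fst p}"
    by (auto simp: A1_def A2_def)
  obtain k1 m1 where tangent1: "\<And>y. fst (field1 X (0, y)) = 0 \<longleftrightarrow> y = m1"
    and r1: "reflects_half_line (enters (field1 X) A1) (half_map (field1 X) A1) k1 m1"
    using center_half_map_reflects [OF centers(1,2), of "- 1", folded sides] by (metis neg_equal_0_iff_equal zero_neq_one)
  obtain k2 m2 where tangent2: "\<And>y. fst (field2 X (0, y)) = 0 \<longleftrightarrow> y = m2"
    and r2: "reflects_half_line (enters (field2 X) A2) (half_map (field2 X) A2) k2 m2"
    using center_half_map_reflects [OF centers(3,4), of "1", folded sides] by (metis zero_neq_one)
  interpret hybrid_reflections X a b k1 m1 k2 m2
    by unfold_locales fact+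
  have "a\<^sup>2 \<noteq> 1" using assms(2) regular_cycle_slope by blast
  have deriv: "(displacement X has_real_derivative a\<^sup>2 - 1) (at y)"
    if "regular_limit_cycle X y" "crosses_transversally X y" for y
    using displacement_derivative [of y] regular_cycle_regular_at [OF that(1), of 0] that(2)
    by (simp add: crosses_transversally_def tangent1 tangent2)
  show ?thesis
  proof (intro conjI allI impI)
    show "\<bar>deriv (poly (reset X)) 0\<bar> \<noteq> 1"
      using \<open>a\<^sup>2 \<noteq> 1\<close> by (simp add: a abs_square_eq_1)
    show "\<exists>!y. regular_limit_cycle X y" using assms(2) regular_cycle_unique by blast
    fix y assume y: "regular_limit_cycle X y"
    then show "cycle_period X y = 1" by (rule regular_cycle_period)
    assume tr: "crosses_transversally X y"
    show "hyperbolic X y"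
      using deriv [OF y tr] \<open>a\<^sup>2 \<noteq> 1\<close> unfolding hyperbolic_def by (intro exI conjI) auto
    show "stable_cycle X y" if "\<bar>deriv (poly (reset X)) 0\<bar> < 1"
      using deriv [OF y tr] that unfolding stable_cycle_def a
      by (intro exI conjI) (auto simp: abs_square_less_1)
    show "unstable_cycle X y" if "\<bar>deriv (poly (reset X)) 0\<bar> > 1"
      using deriv [OF y tr] that abs_square_le_1 [of a] unfolding unstable_cycle_def a
      by (intro exI conjI) auto
  qed
qed

end
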